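(* Let $N \geq 1$ be an integer, $T > 0$, $v \geq 0$, and let $\mathbf{x}_1, \ldots, \mathbf{x}_N : [0,T] \to \mathbb{R}^2$ be trajectories of $N$ UAVs, each moving with speed at most $v$, i.e. $\|\mathbf{x}_i(t) - \mathbf{x}_i(t')\| \leq v|t-t'|$ for all $i \in \{1,\ldots,N\}$ and all $t,t' \in [0,T]$. For $t \in [0,T]$ let $r(t)$ be the communication radius at time $t$, i.e. the smallest $r \geq 0$ such that the graph $\mathcal{G}_r(t)$ on $\{1,\ldots,N\}$, in which distinct $i,j$ are adjacent exactly when $\|\mathbf{x}_i(t) - \mathbf{x}_j(t)\| \leq r$, is connected. Then $r$ is $2v$-Lipschitz continuous on $[0,T]$, that is, $$|r(t) - r(t')| \leq 2v\,|t - t'| \quad \text{for any } t, t' \in [0,T].$$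
   Context: $\|\cdot\|$ is the Euclidean norm on $\mathbb{R}^2$. The UAV network at time $t$ is the weighted complete graph $\mathcal{G}(t) = (\mathcal{N}, \mathcal{E}, w_t)$ with nodes $\mathcal{N} = \{1,\ldots,N\}$, edges $\mathcal{E} = \{(i,j) \mid i,j \in \mathcal{N},\ i \neq j\}$ (undirected), and weights $w_t(i,j) = \|\mathbf{x}_i(t) - \mathbf{x}_j(t)\|$. For $r \geq 0$, $\mathcal{G}_r(t) = (\mathcal{N}, \mathcal{E}_r(t))$ with $\mathcal{E}_r(t) = \{(i,j) \in \mathcal{E} \mid w_t(i,j) \leq r\}$. The communication radius at time $t$ is $r(t) = \min\{ r \geq 0 \mid \mathcal{G}_r(t) \text{ is connected}\}$. *)

theory Defs
  imports "HOL-Analysis.Analysis" "Graph_Theory.Digraph_Component"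
begin

text \<open>
  Undirected graphs are rendered, as usual in the digraph library, by symmetric arc sets: an
  undirected edge between \<open>i\<close> and \<open>j\<close> is the pair of arcs \<open>(i, j)\<close>, \<open>(j, i)\<close>.
\<close>

definition uav_edges :: "nat \<Rightarrow> (nat \<times> nat) set" where
  "uav_edges N = {(i, j). i \<in> {1..N} \<and> j \<in> {1..N} \<and> i \<noteq> j}"

definition uav_weight :: "(nat \<Rightarrow> real \<Rightarrow> real ^ 2) \<Rightarrow> real \<Rightarrow> nat \<Rightarrow> nat \<Rightarrow> real" where
  "uav_weight x t i j = norm (x i t - x j t)"

definition threshold_graph ::
  "nat \<Rightarrow> (nat \<Rightarrow> real \<Rightarrow> real ^ 2) \<Rightarrow> real \<Rightarrow> real \<Rightarrow> nat pair_pre_digraph" where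
  "threshold_graph N x t r =
     \<lparr> pverts = {1..N}, parcs = {(i, j) \<in> uav_edges N. uav_weight x t i j \<le> r} \<rparr>"

text \<open>
  Connectedness is qualified to keep it apart from the topological \<open>connected\<close>.
  The minimum is attained for \<open>N \<ge> 1\<close>, see \<open>communication_radius_is_minimum\<close> below.
\<close>

definition communication_radius ::
  "nat \<Rightarrow> (nat \<Rightarrow> real \<Rightarrow> real ^ 2) \<Rightarrow> real \<Rightarrow> real" where
  "communication_radius N x t =
     (LEAST r. 0 \<le> r \<and> Digraph_Component.connected (with_proj (threshold_graph N x t r)))"

lemma pair_graph_threshold_graph: "pair_graph (threshold_graph N x t r)"
proof
  show "finite (parcs (threshold_graph N x t r))"
    by (rule finite_subset[of _ "{1..N} \<times> {1..N}"])
       (auto simp: threshold_graph_def uav_edges_def)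
qed (auto simp: threshold_graph_def uav_edges_def uav_weight_def symmetric_def
      norm_minus_commute intro!: symI)

lemma communication_radius_is_minimum:
  fixes x :: "nat \<Rightarrow> real \<Rightarrow> real ^ 2" and t :: real
  assumes "N \<ge> 1"
  defines "R \<equiv> {r. 0 \<le> r \<and> Digraph_Component.connected (with_proj (threshold_graph N x t r))}"
  shows "communication_radius N x t \<in> R"
    and "\<And>r. r \<in> R \<Longrightarrow> communication_radius N x t \<le> r"
proof -
  let ?w = "\<lambda>(i, j). uav_weight x t i j"
  define C where "C = insert 0 (?w ` ({1..N} \<times> {1..N}))"
  have C: "finite C" "0 \<in> C" by (auto simp: C_def)
  have round: "\<exists>c\<in>C \<inter> R. c \<le> r" if "r \<in> R" for r
  proof -
    define c where "c = Max {c \<in> C. c \<le> r}"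
    have "0 \<le> r" using that by (simp add: R_def)
    hence ne: "{c \<in> C. c \<le> r} \<noteq> {}" "0 \<in> {c \<in> C. c \<le> r}" using C by auto
    have fin: "finite {c \<in> C. c \<le> r}" using C by auto
    have c: "c \<in> C" "c \<le> r" using Max_in[OF fin ne(1)] by (auto simp: c_def)
    have c0: "0 \<le> c" unfolding c_def by (rule Max_ge[OF fin ne(2)])
    have "uav_weight x t i j \<le> c" if "(i, j) \<in> uav_edges N" "uav_weight x t i j \<le> r" for i j
      unfolding c_def using that by (intro Max_ge[OF fin]) (auto simp: C_def uav_edges_def)
    with c(2) have "threshold_graph N x t c = threshold_graph N x t r"
      by (force simp: threshold_graph_def)
    with c c0 that show ?thesis by (auto simp: R_def)
  qed
  have "R \<noteq> {}"
  proof -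
    have le: "?w p \<le> Max C" if "p \<in> {1..N} \<times> {1..N}" for p
      using that by (intro Max_ge[OF C(1)]) (auto simp: C_def)
    let ?G = "threshold_graph N x t (Max C)"
    interpret pair_graph ?G by (rule pair_graph_threshold_graph)
    have verts: "pverts ?G = {1..N}" by (simp add: threshold_graph_def)
    have "u \<rightarrow>\<^sup>*\<^bsub>with_proj ?G\<^esub> v" if "u \<in> {1..N}" "v \<in> {1..N}" for u v
    proof (cases "u = v")
      case True
      then show ?thesis using that verts by auto
    next
      case False
      hence "(u, v) \<in> parcs ?G"
        using that le[of "(u, v)"] by (auto simp: threshold_graph_def uav_edges_def)
      then show ?thesis by auto
    qed
    hence "strongly_connected (with_proj (mk_symmetric (with_proj ?G)))"
      using assms(1) verts by (intro strongly_connectedI) (auto intro: reachable_mk_symmetricI)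
    hence "Digraph_Component.connected (with_proj ?G)"
      by (simp only: Digraph_Component.connected_def)
    moreover have "0 \<le> Max C" using C by auto
    ultimately show ?thesis by (auto simp: R_def)
  qed
  hence neCR: "C \<inter> R \<noteq> {}" using round by blast
  have finCR: "finite (C \<inter> R)" using C by auto
  define m where "m = Min (C \<inter> R)"
  have mR: "m \<in> R" using Min_in[OF finCR neCR] by (simp add: m_def)
  have mle: "m \<le> r" if "r \<in> R" for r
    using round[OF that] Min_le[OF finCR] unfolding m_def by (meson order_trans)
  have "communication_radius N x t = m"
    unfolding communication_radius_def
    by (rule Least_equality) (use mR mle in \<open>auto simp: R_def\<close>)
  with mR mle show "communication_radius N x t \<in> R"
    and "\<And>r. r \<in> R \<Longrightarrow> communication_radius N x t \<le> r" by auto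
qed

end

theory Submission
  imports Defs
begin

text \<open>Between times \<open>t'\<close> and \<open>t\<close> each UAV moves by at most
  \<open>v * \<bar>t - t'\<bar>\<close>, so every pairwise distance changes by at most
  \<open>d = 2 * v * \<bar>t - t'\<bar>\<close>. Every edge present at \<open>t'\<close> with
  threshold \<open>r(t')\<close> is thus present at \<open>t\<close> with threshold
  \<open>r(t') + d\<close>. Extra edges preserve connectedness
  (\<open>connected_threshold_graph_mono\<close>), so \<open>r(t) \<le> r(t') + d\<close> by
  minimality (\<open>communication_radius_le_add\<close>). Swapping the times gives the other
  inequality.\<close>

text \<open>By \<open>le\<close>, the first graph is a spanning subgraph of the second. Time and
  threshold vary together, so that motion can be offset by a larger radius.\<close>

lemma connected_threshold_graph_mono:
  assumes "Digraph_Component.connected (with_proj (threshold_graph N x t r))"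
    and le: "\<And>i j. (i, j) \<in> uav_edges N \<Longrightarrow> uav_weight x t i j \<le> r \<Longrightarrow> uav_weight x t' i j \<le> r'"
  shows "Digraph_Component.connected (with_proj (threshold_graph N x t' r'))"
proof -
  let ?G = "with_proj (threshold_graph N x t r)" and ?H = "with_proj (threshold_graph N x t' r')"
  interpret G: pair_graph "threshold_graph N x t r" by (rule pair_graph_threshold_graph)
  interpret H: pair_graph "threshold_graph N x t' r'" by (rule pair_graph_threshold_graph)
  have "spanning ?G ?H"
    using le G.wf_digraph_axioms H.wf_digraph_axioms
    by (auto simp: spanning_def subgraph_def compatible_def threshold_graph_def)
  then show ?thesis
    using assms(1) by (rule H.connected_spanning_imp_connected)
qed

text \<open>The minimum at \<open>t'\<close> is attained, so the graph there is connected at the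
  radius itself; enlarging that radius by \<open>d\<close> gives a competitor in the minimum at
  \<open>t\<close>.\<close>

lemma communication_radius_le_add:
  assumes "N \<ge> 1" and "0 \<le> d"
    and le: "\<And>i j. (i, j) \<in> uav_edges N \<Longrightarrow> uav_weight x t i j \<le> uav_weight x t' i j + d"
  shows "communication_radius N x t \<le> communication_radius N x t' + d"
proof -
  note min = communication_radius_is_minimum[OF assms(1)]
  have "Digraph_Component.connected
      (with_proj (threshold_graph N x t (communication_radius N x t' + d)))"
    by (rule connected_threshold_graph_mono[of N x t' "communication_radius N x t'"])
       (use min(1)[of x t'] in simp, use le in fastforce)
  \<comment> \<open>Here \<open>0 \<le> d\<close> ensures that the competing radius is
    nonnegative.\<close>
  with min(1)[of x t'] assms(2) show ?thesis by (intro min(2)) simp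
qed

theorem theorem1:
  fixes N :: nat and T v :: real and x :: "nat \<Rightarrow> real \<Rightarrow> real ^ 2"
  assumes "N \<ge> 1" and "T > 0" and "v \<ge> 0"
    and speed: "\<forall>i\<in>{1..N}. \<forall>t\<in>{0..T}. \<forall>t'\<in>{0..T}. norm (x i t - x i t') \<le> v * \<bar>t - t'\<bar>"
  shows "(2 * v)-lipschitz_on {0..T} (communication_radius N x) \<and>
    (\<forall>t\<in>{0..T}. \<forall>t'\<in>{0..T}.
      \<bar>communication_radius N x t - communication_radius N x t'\<bar> \<le> 2 * v * \<bar>t - t'\<bar>)"
proof -
  have one_sided: "communication_radius N x t \<le> communication_radius N x t' + 2 * v * \<bar>t - t'\<bar>"
    if t: "t \<in> {0..T}" "t' \<in> {0..T}" for t t'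
  proof (rule communication_radius_le_add)
    fix i j assume "(i, j) \<in> uav_edges N"
    then have "norm (x i t - x i t') \<le> v * \<bar>t - t'\<bar>" "norm (x j t - x j t') \<le> v * \<bar>t - t'\<bar>"
      using speed t by (auto simp: uav_edges_def)
    \<comment> \<open>Triangle inequality through the positions at \<open>t'\<close>; the
      displacements of the two endpoints account for the factor 2.\<close>
    moreover have "norm (x i t - x j t)
        \<le> norm (x i t' - x j t') + norm (x i t - x i t') + norm (x j t - x j t')"
      by norm
    ultimately show "uav_weight x t i j \<le> uav_weight x t' i j + 2 * v * \<bar>t - t'\<bar>"
      by (simp add: uav_weight_def)
  qed (use assms in auto)
  have bound: "\<bar>communication_radius N x t - communication_radius N x t'\<bar> \<le> 2 * v * \<bar>t - t'\<bar>"
    if "t \<in> {0..T}" "t' \<in> {0..T}" for t t'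
    using one_sided[OF that] one_sided[OF that(2,1)] by (simp add: abs_minus_commute abs_le_iff)
  moreover have "(2 * v)-lipschitz_on {0..T} (communication_radius N x)"
    using bound \<open>v \<ge> 0\<close> by (intro lipschitz_onI) (auto simp: dist_real_def)
  ultimately show ?thesis by blast
qed

end
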